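(* For an integer $d\ge 0$ let $f(d)$ be the number of squares that a knight on an infinite chessboard can reach in (exactly) $d$ moves from a fixed starting square. Then $$f(d)=\begin{cases}1 & d=0,\\ 8 & d=1,\\ 33 & d=2,\\ 1+4d+7d^2 & d\ge 3.\end{cases}$$
   Context: The infinite chessboard has squares identified with $\mathbb{Z}^2$. A knight move adds to the current position one of the eight vectors $(\pm1,\pm2)$, $(\pm2,\pm1)$ (all sign choices). A square is reached in $d$ moves if it is the final position of some sequence of exactly $d$ knight moves from the starting square; squares may be revisited. *)

theory Defs
  imports Main "HOL-Library.Product_Plus"
begin

type_synonym square = "int \<times> int"

definition knight_vectors :: "(int \<times> int) set" where
  "knight_vectors =
     {(1, 2), (1, -2), (-1, 2), (-1, -2), (2, 1), (2, -1), (-2, 1), (-2, -1)}"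

definition knight_move :: "square rel" where
  "knight_move = {(p, q). \<exists>v \<in> knight_vectors. q = p + v}"

definition reached_squares :: "square \<Rightarrow> nat \<Rightarrow> square set" where
  "reached_squares s d = {t. (s, t) \<in> knight_move ^^ d}"

(* The cardinality claim cannot hold by accident for an infinite set, where card
   is 0, since all claimed values are positive. *)
definition knight_count :: "square \<Rightarrow> nat \<Rightarrow> nat" where
  "knight_count s d = card (reached_squares s d)"

end

theory Submission
  imports Defs
begin

text \<open>
  After \<^term>\<open>d\<close> moves the displacement \<open>(x, y)\<close> satisfies \<open>\<bar>x\<bar> \<le> 2d\<close>, \<open>\<bar>y\<bar> \<le> 2d\<close>,
  \<open>\<bar>x\<bar> + \<bar>y\<bar> \<le> 3d\<close> and \<open>x + y \<equiv> d (mod 2)\<close>, because each knight vector obeys these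
  conditions for \<open>d = 1\<close> and they add up.  These conditions cut out an octagonal piece of one colour class of the
  board.  For \<open>d \<ge> 3\<close> nothing else restricts the knight: a point of the octagon of size \<open>d + 1\<close>
  enters the octagon of size \<open>d\<close> by the move that goes towards the origin by 2 in the direction of
  the larger coordinate and by 1 in the other (\<open>octagon_Suc_greedy\<close>).  That induction
  cannot start before \<open>d = 2\<close>, where exactly the four points \<open>(\<plusminus>2, \<plusminus>2)\<close> are missing
  (\<open>reached_two\<close>); a single point of the octagon of size 3, up to symmetry, is sent by the greedy
  move to one of them, and another move serves for it.

  In the coordinates \<open>(x + y + 3d) / 2\<close> and \<open>(x - y + 3d) / 2\<close> the colour class becomes the whole
  lattice, the condition on \<open>\<bar>x\<bar> + \<bar>y\<bar>\<close> a square of side \<open>3d + 1\<close> points, and the bounds on \<open>x\<close>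
  and \<open>y\<close> cut from it four corner triangles with \<open>d (d + 1) / 2\<close> points each.  This leaves
  \<open>(3d + 1)\<^sup>2 - 2d (d + 1) = 1 + 4d + 7d\<^sup>2\<close> points (\<open>card_octagon\<close>), and four fewer for
  \<open>d = 2\<close>.
\<close>

section \<open>The octagon and its number of points\<close>

definition octagon :: "nat \<Rightarrow> square set" where
  "octagon d = {(x, y). \<bar>x\<bar> \<le> 2 * int d \<and> \<bar>y\<bar> \<le> 2 * int d \<and> \<bar>x\<bar> + \<bar>y\<bar> \<le> 3 * int d
                        \<and> even (x + y + int d)}"

text \<open>An image of pairs of natural numbers, so that the count is a sum over naturals; \<open>mem_corner\<close>
  gives the inequalities.\<close>

definition corner :: "nat \<Rightarrow> square set" where
  "corner d = (\<lambda>(i, j). (int i, int j)) ` (SIGMA i : {..<d}. {..<d - i})"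

lemma mem_corner: "(x, y) \<in> corner d \<longleftrightarrow> 0 \<le> x \<and> 0 \<le> y \<and> x + y < int d"
proof
  assume "(x, y) \<in> corner d"
  then show "0 \<le> x \<and> 0 \<le> y \<and> x + y < int d" by (auto simp: corner_def)
next
  assume "0 \<le> x \<and> 0 \<le> y \<and> x + y < int d"
  then have "(nat x, nat y) \<in> (SIGMA i : {..<d}. {..<d - i})" "(x, y) = (int (nat x), int (nat y))"
    by auto
  then show "(x, y) \<in> corner d"
    unfolding corner_def by (intro image_eqI[of _ _ "(nat x, nat y)"]) simp_all
qed

lemma finite_corner: "finite (corner d)"
  by (simp add: corner_def)

lemma card_corner: "2 * card (corner d) = d * (d + 1)"
proof -
  have "card (corner d) = card (SIGMA i : {..<d}. {..<d - i})"
    unfolding corner_def by (rule card_image) (auto simp: inj_on_def)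
  also have "\<dots> = (\<Sum>i<d. d - i)" by simp
  also have "\<dots> = (\<Sum>i<d. Suc i)"
    by (subst sum.nat_diff_reindex[symmetric]) (auto intro!: sum.cong)
  finally have "card (corner d) = (\<Sum>i<d. Suc i)" .
  moreover have "2 * (\<Sum>i<d. Suc i) = d * (d + 1)"
    by (induction d) (auto simp: algebra_simps)
  ultimately show ?thesis by simp
qed

lemma card_octagon: "card (octagon d) = 1 + 4 * d + 7 * d ^ 2"
proof -
  define n where "n = 3 * int d"
  define Q where "Q = {0..n} \<times> {0..n}"
  define O' where "O' = {(u, v). (u, v) \<in> Q \<and> \<bar>u + v - n\<bar> \<le> 2 * int d \<and> \<bar>u - v\<bar> \<le> 2 * int d}"
  \<comment> \<open>\<open>Q\<close> is the square in the coordinates \<open>u = (x + y + 3d) / 2\<close>, \<open>v = (x - y + 3d) / 2\<close>, and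
     \<open>C1\<close>, \<dots>, \<open>C4\<close> are the corners that the bounds on \<open>x = u + v - 3d\<close> and \<open>y = u - v\<close>
     cut off.\<close>
  define C1 where "C1 = corner d"
  define C2 where "C2 = (\<lambda>(i, j). (n - i, j)) ` corner d"
  define C3 where "C3 = (\<lambda>(i, j). (i, n - j)) ` corner d"
  define C4 where "C4 = (\<lambda>(i, j). (n - i, n - j)) ` corner d"
  note defs = C1_def C2_def C3_def C4_def
  have img: "octagon d = (\<lambda>(u, v). (u + v - n, u - v)) ` O'"
  proof (intro set_eqI iffI)
    fix p assume "p \<in> octagon d"
    then obtain x y where p: "p = (x, y)" and o: "\<bar>x\<bar> \<le> 2 * int d" "\<bar>y\<bar> \<le> 2 * int d"
        "\<bar>x\<bar> + \<bar>y\<bar> \<le> n" "even (x + y + int d)"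
      by (auto simp: octagon_def n_def)
    obtain k where k: "x + y + int d = 2 * k" using o(4) by blast
    have "(x, y) = (\<lambda>(u, v). (u + v - n, u - v)) (k + int d, k + int d - y)"
      using k by (simp add: n_def)
    moreover have "(k + int d, k + int d - y) \<in> O'"
      using o k by (auto simp: O'_def Q_def n_def)
    ultimately show "p \<in> (\<lambda>(u, v). (u + v - n, u - v)) ` O'" unfolding p by (rule image_eqI)
  next
    fix p assume "p \<in> (\<lambda>(u, v). (u + v - n, u - v)) ` O'"
    then obtain u v where p: "p = (u + v - n, u - v)" and o: "(u, v) \<in> O'" by auto
    have "u + v - n + (u - v) + int d = 2 * (u - int d)" by (simp add: n_def)
    then have "even (u + v - n + (u - v) + int d)" by (metis dvd_triv_left)
    then show "p \<in> octagon d" using o unfolding p by (auto simp: octagon_def O'_def Q_def n_def)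
  qed
  have inj: "inj_on (\<lambda>(u, v). (u + v - n, u - v)) O'" by (auto simp: inj_on_def)
  have card: "card C1 = card (corner d)" "card C2 = card (corner d)"
       "card C3 = card (corner d)" "card C4 = card (corner d)"
    unfolding defs by (auto intro!: card_image simp: inj_on_def)
  have fin: "finite C1" "finite C2" "finite C3" "finite C4"
    by (simp_all add: defs finite_corner)
  have mem: "(u, v) \<in> C1 \<longleftrightarrow> 0 \<le> u \<and> 0 \<le> v \<and> u + v < int d"
    "(u, v) \<in> C2 \<longleftrightarrow> u \<le> n \<and> 0 \<le> v \<and> n - u + v < int d"
    "(u, v) \<in> C3 \<longleftrightarrow> 0 \<le> u \<and> v \<le> n \<and> u + (n - v) < int d"
    "(u, v) \<in> C4 \<longleftrightarrow> u \<le> n \<and> v \<le> n \<and> (n - u) + (n - v) < int d" for u v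
  proof -
    have "(u, v) \<in> C2 \<longleftrightarrow> (n - u, v) \<in> corner d"
      "(u, v) \<in> C3 \<longleftrightarrow> (u, n - v) \<in> corner d"
      "(u, v) \<in> C4 \<longleftrightarrow> (n - u, n - v) \<in> corner d"
      unfolding defs by force+
    then show "(u, v) \<in> C1 \<longleftrightarrow> 0 \<le> u \<and> 0 \<le> v \<and> u + v < int d"
      "(u, v) \<in> C2 \<longleftrightarrow> u \<le> n \<and> 0 \<le> v \<and> n - u + v < int d"
      "(u, v) \<in> C3 \<longleftrightarrow> 0 \<le> u \<and> v \<le> n \<and> u + (n - v) < int d"
      "(u, v) \<in> C4 \<longleftrightarrow> u \<le> n \<and> v \<le> n \<and> (n - u) + (n - v) < int d"
      by (simp_all add: C1_def mem_corner)
  qed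
  have "Q = O' \<union> (C1 \<union> C2 \<union> C3 \<union> C4)" "O' \<inter> (C1 \<union> C2 \<union> C3 \<union> C4) = {}"
      "C1 \<inter> C2 = {}" "(C1 \<union> C2) \<inter> C3 = {}" "(C1 \<union> C2 \<union> C3) \<inter> C4 = {}"
    by (auto simp: mem Q_def O'_def n_def)
  moreover have "finite O'"
    by (rule finite_subset[of _ Q]) (auto simp: O'_def Q_def)
  ultimately have "card Q = card O' + 4 * card (corner d)"
    using fin by (simp add: card_Un_disjoint card)
  moreover have "card Q = (3 * d + 1) ^ 2"
    by (simp add: Q_def n_def power2_eq_square nat_add_distrib nat_mult_distrib)
  ultimately have "card O' + 2 * (d * (d + 1)) = (3 * d + 1) ^ 2"
    using card_corner[of d] by simp
  then show ?thesis
    using img inj by (simp add: card_image power2_eq_square algebra_simps)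
qed

section \<open>Which squares are reached\<close>

lemma reached_squares_0: "reached_squares s 0 = {s}"
  by (auto simp: reached_squares_def)

lemma reached_squares_Suc:
  "t \<in> reached_squares s (Suc d) \<longleftrightarrow> (\<exists>v \<in> knight_vectors. t - v \<in> reached_squares s d)"
proof -
  have "(\<exists>p. P p \<and> (\<exists>v \<in> V. t = p + v)) \<longleftrightarrow> (\<exists>v \<in> V. P (t - v))" for P V
    by (metis add_diff_cancel_right' diff_add_cancel)
  then show ?thesis
    by (simp add: reached_squares_def knight_move_def relcomp_unfold)
qed

lemma reached_squares_translate: "t \<in> reached_squares s d \<longleftrightarrow> t - s \<in> reached_squares 0 d"
proof (induction d arbitrary: t)
  case 0
  show ?case by (simp add: reached_squares_0)
next
  case (Suc d)
  show ?case by (simp add: reached_squares_Suc Suc.IH diff_right_commute)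
qed

lemma knight_count_translate: "knight_count s d = card (reached_squares 0 d)"
proof -
  have "reached_squares s d = (+) s ` reached_squares 0 d"
  proof (intro set_eqI iffI)
    fix t assume "t \<in> reached_squares s d"
    then have "t - s \<in> reached_squares 0 d" using reached_squares_translate by blast
    then show "t \<in> (+) s ` reached_squares 0 d" by (rule rev_image_eqI) simp
  next
    fix t assume "t \<in> (+) s ` reached_squares 0 d"
    then show "t \<in> reached_squares s d" using reached_squares_translate[of t s d] by auto
  qed
  then show ?thesis by (simp add: knight_count_def card_image)
qed

lemma reached_one: "reached_squares 0 1 = knight_vectors"
  unfolding One_nat_def set_eq_iff reached_squares_Suc reached_squares_0 by auto

lemma mem_knight_vectors:
  "(a, b) \<in> knight_vectors \<longleftrightarrow> \<bar>a\<bar> = 1 \<and> \<bar>b\<bar> = 2 \<or> \<bar>a\<bar> = 2 \<and> \<bar>b\<bar> = 1"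
  by (simp add: knight_vectors_def abs_eq_iff') blast

lemma odd_knight_vector: "(a, b) \<in> knight_vectors \<Longrightarrow> odd (a + b)"
  by (auto simp: knight_vectors_def)

lemma reached_subset_octagon: "reached_squares 0 d \<subseteq> octagon d"
proof (induction d)
  case 0
  show ?case by (simp add: reached_squares_0 octagon_def zero_prod_def)
next
  case (Suc d)
  show ?case
  proof
    fix p assume "p \<in> reached_squares 0 (Suc d)"
    then obtain v where v: "v \<in> knight_vectors" and o: "p - v \<in> octagon d"
      using Suc by (auto simp: reached_squares_Suc)
    obtain x y a b where p: "p = (x, y)" "v = (a, b)" by (cases p, cases v)
    have "\<bar>a\<bar> \<le> 2" "\<bar>b\<bar> \<le> 2" "\<bar>a\<bar> + \<bar>b\<bar> = 3"
      using v by (auto simp: p mem_knight_vectors)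
    moreover have "\<bar>x - a\<bar> \<le> 2 * int d" "\<bar>y - b\<bar> \<le> 2 * int d" "\<bar>x - a\<bar> + \<bar>y - b\<bar> \<le> 3 * int d"
      and e: "even (x - a + (y - b) + int d)"
      using o by (simp_all add: p octagon_def)
    ultimately have "\<bar>x\<bar> \<le> 2 * int d + 2" "\<bar>y\<bar> \<le> 2 * int d + 2" "\<bar>x\<bar> + \<bar>y\<bar> \<le> 3 * int d + 3"
      by linarith+
    moreover have "odd (a + b)"
      using v p odd_knight_vector by simp
    then have "even (x + y + int d + 1)"
      using e by presburger
    ultimately show "p \<in> octagon (Suc d)"
      by (simp add: p octagon_def algebra_simps)
  qed
qed

definition greedy :: "square \<Rightarrow> square" where
  "greedy = (\<lambda>(x, y). let a = (if x \<ge> 0 then 1 else -1); b = (if y \<ge> 0 then 1 else -1)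
     in if \<bar>x\<bar> \<ge> \<bar>y\<bar> then (2 * a, b) else (a, 2 * b))"

lemma greedy_knight_vector: "greedy p \<in> knight_vectors"
  by (cases p) (simp add: greedy_def knight_vectors_def Let_def)

text \<open>The absolute values of the coordinates drop by 2 and 1 unless the move crosses an axis.  That
  happens only if the smaller coordinate is 0 or the larger one is at most 1 in absolute value; the
  absolute values then add up to at most \<open>2d + 1\<close>, or to at most 3, after the move, which is at
  most \<open>3d\<close> as soon as \<open>d \<ge> 1\<close>.\<close>

lemma octagon_Suc_greedy:
  assumes "p \<in> octagon (Suc d)" "d \<ge> 1"
  shows "p - greedy p \<in> octagon d"
proof -
  obtain x y where p: "p = (x, y)" by (cases p)
  have o: "\<bar>x\<bar> \<le> 2 * int d + 2" "\<bar>y\<bar> \<le> 2 * int d + 2" "\<bar>x\<bar> + \<bar>y\<bar> \<le> 3 * int d + 3"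
    and e: "even (x + y + int d + 1)"
    using assms(1) by (simp_all add: p octagon_def algebra_simps)
  obtain a b where g: "greedy p = (a, b)" by (cases "greedy p")
  have "\<bar>x - a\<bar> \<le> 2 * int d \<and> \<bar>y - b\<bar> \<le> 2 * int d \<and> \<bar>x - a\<bar> + \<bar>y - b\<bar> \<le> 3 * int d"
    using o g assms(2) by (auto simp: p greedy_def Let_def abs_if split: if_splits)
  moreover have "odd (a + b)"
    using g greedy_knight_vector[of p] odd_knight_vector by simp
  then have "even (x - a + (y - b) + int d)"
    using e by presburger
  ultimately show ?thesis unfolding g unfolding p by (simp add: octagon_def)
qed

definition diagonal_points :: "square set" where
  "diagonal_points = {2, -2} \<times> {2, -2}"

text \<open>For \<open>d = 2\<close> the target must avoid \<open>(\<plusminus>2, \<plusminus>2)\<close>.  The greedy move hits such a point only from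
  \<open>(\<plusminus>4, \<plusminus>3)\<close> and \<open>(\<plusminus>3, \<plusminus>4)\<close>, and there going by 1 along the larger coordinate works.\<close>

lemma octagon_three_step:
  assumes "p \<in> octagon 3"
  shows "\<exists>v \<in> knight_vectors. p - v \<in> octagon 2 - diagonal_points"
proof (cases "p - greedy p \<in> diagonal_points")
  case False
  then show ?thesis
    using octagon_Suc_greedy[of p 2] assms greedy_knight_vector[of p] by auto
next
  case True
  obtain x y where p: "p = (x, y)" by (cases p)
  have "(\<bar>x\<bar> = 4 \<and> \<bar>y\<bar> = 3) \<or> (\<bar>x\<bar> = 3 \<and> \<bar>y\<bar> = 4)"
    using True assms
    by (auto simp: p greedy_def Let_def diagonal_points_def octagon_def split: if_splits)
  then have "p \<in> {(4, 3), (4, -3), (-4, 3), (-4, -3), (3, 4), (3, -4), (-3, 4), (-3, -4)}"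
    by (simp add: p abs_eq_iff') blast
  then show ?thesis
    by (elim insertE; simp add: knight_vectors_def octagon_def diagonal_points_def)
qed

lemma mem_reached_two: "p \<in> reached_squares 0 2 \<longleftrightarrow> (\<exists>v \<in> knight_vectors. p - v \<in> knight_vectors)"
  using reached_squares_Suc[of p 0 1] reached_one by (simp only: Suc_1)

lemma reached_two: "reached_squares 0 2 = octagon 2 - diagonal_points"
proof (intro equalityI subsetI)
  fix p assume p: "p \<in> reached_squares 0 2"
  then have "\<exists>v \<in> knight_vectors. p - v \<in> knight_vectors"
    by (simp only: mem_reached_two)
  moreover have "\<forall>q \<in> diagonal_points. \<forall>v \<in> knight_vectors. q - v \<notin> knight_vectors"
    by (simp add: diagonal_points_def knight_vectors_def)
  ultimately have "p \<notin> diagonal_points" by blast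
  then show "p \<in> octagon 2 - diagonal_points"
    using p reached_subset_octagon by blast
next
  fix p assume p: "p \<in> octagon 2 - diagonal_points"
  obtain x y where xy: "p = (x, y)" by (cases p)
  have "\<forall>x \<in> {-4,-3,-2,-1,0,1,2,3,4}. \<forall>y \<in> {-4,-3,-2,-1,0,1,2,3,4}.
      (x, y) \<in> octagon 2 - diagonal_points
        \<longrightarrow> (\<exists>v \<in> knight_vectors. (x, y) - v \<in> knight_vectors)"
    by (simp add: knight_vectors_def octagon_def diagonal_points_def)
  moreover have "x \<in> {-4..4}" "y \<in> {-4..4}" using p by (auto simp: xy octagon_def)
  moreover have "{-4..4} = {-4,-3,-2,-1,0,1,2,3,4::int}" by auto
  ultimately have "\<exists>v \<in> knight_vectors. p - v \<in> knight_vectors"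
    using p unfolding xy by metis
  then show "p \<in> reached_squares 0 2"
    by (simp only: mem_reached_two)
qed

lemma reached_eq_octagon:
  assumes "d \<ge> 3"
  shows "reached_squares 0 d = octagon d"
proof
  show "octagon d \<subseteq> reached_squares 0 d"
    using assms
  proof (induction d rule: nat_induct_at_least)
    case base
    have "p \<in> reached_squares 0 (Suc 2)" if "p \<in> octagon 3" for p
      using octagon_three_step[OF that] by (simp only: reached_squares_Suc reached_two)
    then show ?case by (simp add: subset_iff)
  next
    case (Suc d)
    then show ?case using octagon_Suc_greedy[of _ d] greedy_knight_vector
      by (fastforce simp: reached_squares_Suc)
  qed
qed (rule reached_subset_octagon)

theorem mainTheorem4:
  fixes s :: square and d :: nat
  shows "knight_count s d =
    (if d = 0 then 1
     else if d = 1 then 8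
     else if d = 2 then 33
     else 1 + 4 * d + 7 * d ^ 2)"
proof -
  consider "d = 0" | "d = 1" | "d = 2" | "d \<ge> 3" by linarith
  then show ?thesis
  proof cases
    case 1
    then show ?thesis by (simp add: knight_count_translate reached_squares_0)
  next
    case 2
    then show ?thesis
      by (simp add: knight_count_translate reached_one[unfolded One_nat_def] knight_vectors_def)
  next
    case 3
    have "diagonal_points \<subseteq> octagon 2" by (auto simp: diagonal_points_def octagon_def)
    moreover have "card diagonal_points = 4" "finite diagonal_points"
      by (simp_all add: diagonal_points_def)
    ultimately show ?thesis using 3
      by (simp add: knight_count_translate reached_two card_Diff_subset card_octagon)
  next
    case 4
    then show ?thesis by (simp add: knight_count_translate reached_eq_octagon card_octagon)
  qed
qed

end
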